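(* Let $\mathcal N:\mathbb R^n\to\mathbb R^m$ be a feed-forward ReLU network, $D\subseteq\mathbb R^n$ a compact domain (box or polytope), and $\mathrm{Safety}$ a safety predicate on the network output. Consider either of the two procedures ICL-Verifier and HSRV (described in the context), run on $(\mathcal N,D,\mathrm{Safety})$. (1) If the procedure returns UNSAT, then $\mathrm{Safety}(\mathcal N(x))$ is true for all $x\in D$. (2) If the procedure returns SAT with witness $x^\star$, then $x^\star\in D$ and $\neg\mathrm{Safety}(\mathcal N(x^\star))$ holds.
   Context: Network: $z^{(0)}=x$, $s^{(i)}=W^{(i)}z^{(i-1)}+b^{(i)}$, $z^{(i)}=\sigma(s^{(i)})$ for $i=1,\dots,L$, with $\sigma$ the componentwise ReLU on hidden layers and the identity on the output layer; $\mathcal N(x)=z^{(L)}$; all data are rational. A ReLU unit $\nu$ has pre-activation $s_\nu$ and post-activation $z_\nu=\max(0,s_\nu)$. The vector $v$ collects all variables $x,s^{(i)},z^{(i)}$. $\mathrm{Safety}$ is a predicate on $z^{(L)}$ and $\neg\mathrm{Safety}$ is encoded exactly by a finite system $\Phi_{\neg P}$ of linear constraints. For a region $R\subseteq D$ and a partial assignment $\alpha$ of phases (active/inactive) to ReLU units, $\mathrm{Exact}(R,\alpha)$ is the set of all $v$ satisfying all network equations exactly, $x\in R$, and, for each unit $\nu$ assigned by $\alpha$, $z_\nu=s_\nu\wedge s_\nu\ge0$ (active) or $z_\nu=0\wedge s_\nu\le0$ (inactive). Refinement replaces $(R,\alpha)$ by children $(R_1,\alpha_1),(R_2,\alpha_2)$,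 either by partitioning $R$ or by committing one ReLU unit to active/inactive; in all cases $\mathrm{Exact}(R,\alpha)=\mathrm{Exact}(R_1,\alpha_1)\cup\mathrm{Exact}(R_2,\alpha_2)$. ICL-Verifier. Keep a global set $\Phi_{\mathrm{learn}}$ (initially empty) of linear lemmas, each satisfied by every $v\in\mathrm{Exact}(D,\emptyset)$, and a worklist $Q$, initially $\{(D,\emptyset)\}$. While $Q\ne\emptyset$ and resources remain: pop $(R,\alpha)$. (a) Propagation: start from the linear store $C$ consisting of the affine layer equations, $x\in R$, $\Phi_{\neg P}$, the linear consequences of the phases in $\alpha$, and $\Phi_{\mathrm{learn}}$. Repeatedly add: for ReLU units with bounds $l_\nu\le s_\nu\le u_\nu$ entailed by the store and $l_\nu<0<u_\nu$, the envelope $z_\nu\ge0$, $z_\nu\ge s_\nu$, $z_\nu\le\frac{u_\nu}{u_\nu-l_\nu}(s_\nu-l_\nu)$, $z_\nu\le u_\nu$; linear bounds $g^\top v\le\beta$ entailed by the store; the specialization $z_\nu=s_\nu,\ s_\nu\ge0$ (resp. $z_\nu=0,\ s_\nu\le0$), replacing the envelope, for units whose store entails $s_\nu\ge0$ (resp. $s_\nu\le0$). If $C$ becomes infeasible, the node is pruned (discarded). (b) Otherwise take a point $\hat v$ satisfying $C$, with input part $\hat x$, and evaluate $\mathcal N(\hat x)$ exactly; if $\hat x\in R$ and $\neg\mathrm{Safety}(\mathcal N(\hat x))$, return SAT with $x^\star=\hat x$. (c) Otherwise, optionally run an exact check: decide satisfiability of $C$ with the exact ReLU semantics imposed on some subset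 of the units that are still unstable; if it returns UNSAT, discard the node. (d) Otherwise refine $(R,\alpha)$ and push the children into $Q$. If $Q$ becomes empty, return UNSAT; if resources run out first, return UNKNOWN. HSRV. Keep a worklist $Q$ of regions, initially $\{D\}$, and a set $L$ of learned constraints, each valid for every $v\in\mathrm{Exact}(D,\emptyset)$. While $Q\neq\emptyset$: pop $R$; compute sound bounds on pre-activations over $R$; build a sound linear relaxation $C_{\mathrm{relax}}(R)$ (every $v\in\mathrm{Exact}(R,\emptyset)$ satisfies it); if $C_{\mathrm{relax}}(R)$ implies $\mathrm{Safety}$ on $R$, discard $R$. Otherwise build the exact constraints $C_{\mathrm{exact}}(R)$ (exact network semantics over $R$) and query a solver, whose SAT/UNSAT answers are correct but which may also answer unknown, on $C_{\mathrm{exact}}(R)\wedge\neg\mathrm{Safety}$ together with $L$: on SAT return SAT with the input part $x$ of the model; on UNSAT discard $R$; on unknown partition $R$ into $R_1,R_2$ and push both. When $Q$ is empty return UNSAT. *)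

theory Defs
  imports "HOL-Analysis.Analysis" "HOL-Library.Multiset"
begin

section \<open>Networks\<close>

text \<open>Layers have varying dimensions, so a vector of dimension \<open>n\<close> is a function on \<^typ>\<open>nat\<close>
  that vanishes from index \<open>n\<close> on. The topology that \<^typ>\<open>nat \<Rightarrow> real\<close> (product topology) induces
  on \<open>Rvec n\<close> is the Euclidean one, so \<open>compact\<close> has its usual meaning.\<close>

definition Rvec :: "nat \<Rightarrow> (nat \<Rightarrow> real) set" where
  "Rvec n = {x. \<forall>k\<ge>n. x k = 0}"

text \<open>\<open>weight N i j k\<close> is the entry \<open>(j, k)\<close> of the matrix of layer \<open>i\<close>, for \<open>i = 1, \<dots>, depth N\<close>;
  \<open>width N 0\<close> is the input dimension.\<close>

record network =
  depth :: nat
  width :: "nat \<Rightarrow> nat"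
  weight :: "nat \<Rightarrow> nat \<Rightarrow> nat \<Rightarrow> real"
  bias :: "nat \<Rightarrow> nat \<Rightarrow> real"

definition wf_network :: "network \<Rightarrow> bool" where
  "wf_network N \<longleftrightarrow> depth N \<ge> 1 \<and>
     (\<forall>i\<in>{1..depth N}. \<forall>j<width N i.
        bias N i j \<in> \<rat> \<and> (\<forall>k<width N (i - 1). weight N i j k \<in> \<rat>))"

primrec layer :: "network \<Rightarrow> (nat \<Rightarrow> real) \<Rightarrow> nat \<Rightarrow> nat \<Rightarrow> real" where
  "layer N x 0 = x"
| "layer N x (Suc i) = (\<lambda>j. if j < width N (Suc i) then
       (let s = (\<Sum>k<width N i. weight N (Suc i) j k * layer N x i k) + bias N (Suc i) j
        in if Suc i < depth N then max 0 s else s)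
     else 0)"

definition eval_net :: "network \<Rightarrow> (nat \<Rightarrow> real) \<Rightarrow> (nat \<Rightarrow> real)" where
  "eval_net N x = layer N x (depth N)"


section \<open>Variables and linear constraints\<close>

text \<open>\<open>Pre i j\<close> is \<open>s\<^sup>i\<^sub>j\<close> and \<open>Post i j\<close> is \<open>z\<^sup>i\<^sub>j\<close>. Since the layer-0 output is the input,
  \<open>Post 0 k\<close> is the input variable \<open>x\<^sub>k\<close>.\<close>

datatype var = Pre nat nat | Post nat nat

type_synonym valuation = "var \<Rightarrow> real"

definition vars :: "network \<Rightarrow> var set" where
  "vars N = {Post 0 k |k. k < width N 0} \<union>
     {Pre i j |i j. i \<in> {1..depth N} \<and> j < width N i} \<union>
     {Post i j |i j. i \<in> {1..depth N} \<and> j < width N i}"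

definition valuations :: "network \<Rightarrow> valuation set" where
  "valuations N = {v. \<forall>u. u \<notin> vars N \<longrightarrow> v u = 0}"

definition inp :: "valuation \<Rightarrow> (nat \<Rightarrow> real)" where
  "inp v = (\<lambda>k. v (Post 0 k))"

definition outp :: "network \<Rightarrow> valuation \<Rightarrow> (nat \<Rightarrow> real)" where
  "outp N v = (\<lambda>k. v (Post (depth N) k))"

datatype cmp = Le | Lt | Ge | Gt | Eq

fun compare :: "cmp \<Rightarrow> real \<Rightarrow> real \<Rightarrow> bool" where
  "compare Le a b \<longleftrightarrow> a \<le> b"
| "compare Lt a b \<longleftrightarrow> a < b"
| "compare Ge a b \<longleftrightarrow> a \<ge> b"
| "compare Gt a b \<longleftrightarrow> a > b"
| "compare Eq a b \<longleftrightarrow> a = b"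

text \<open>\<open>LC g r \<beta>\<close> is the constraint comparing \<open>g\<^sup>T v\<close> with \<open>\<beta>\<close>.\<close>

datatype lincon = LC "var \<Rightarrow> real" cmp real

fun holds :: "network \<Rightarrow> lincon \<Rightarrow> valuation \<Rightarrow> bool" where
  "holds N (LC g r \<beta>) v \<longleftrightarrow> compare r (\<Sum>u\<in>vars N. g u * v u) \<beta>"

definition sat :: "network \<Rightarrow> lincon set \<Rightarrow> valuation \<Rightarrow> bool" where
  "sat N C v \<longleftrightarrow> (\<forall>c\<in>C. holds N c v)"

definition feasible :: "network \<Rightarrow> lincon set \<Rightarrow> bool" where
  "feasible N C \<longleftrightarrow> (\<exists>v\<in>valuations N. sat N C v)"

definition entails :: "network \<Rightarrow> lincon set \<Rightarrow> lincon \<Rightarrow> bool" where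
  "entails N C c \<longleftrightarrow> (\<forall>v\<in>valuations N. sat N C v \<longrightarrow> holds N c v)"

definition encodes :: "network \<Rightarrow> lincon set \<Rightarrow> (valuation \<Rightarrow> bool) \<Rightarrow> bool" where
  "encodes N C P \<longleftrightarrow> finite C \<and> (\<forall>v\<in>valuations N. sat N C v \<longleftrightarrow> P v)"

fun rational_con :: "network \<Rightarrow> lincon \<Rightarrow> bool" where
  "rational_con N (LC g r \<beta>) \<longleftrightarrow> (\<forall>u\<in>vars N. g u \<in> \<rat>) \<and> \<beta> \<in> \<rat>"

fun nonstrict :: "lincon \<Rightarrow> bool" where
  "nonstrict (LC g r \<beta>) \<longleftrightarrow> r \<in> {Le, Ge, Eq}"


section \<open>Domains and regions\<close>

definition rational_box :: "nat \<Rightarrow> (nat \<Rightarrow> real) set \<Rightarrow> bool" where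
  "rational_box n D \<longleftrightarrow> (\<exists>l u. (\<forall>k<n. l k \<in> \<rat> \<and> u k \<in> \<rat>) \<and>
     D = {x \<in> Rvec n. \<forall>k<n. l k \<le> x k \<and> x k \<le> u k})"

definition rational_polyhedron :: "network \<Rightarrow> (nat \<Rightarrow> real) set \<Rightarrow> bool" where
  "rational_polyhedron N D \<longleftrightarrow> D \<subseteq> Rvec (width N 0) \<and>
     (\<exists>H. encodes N H (\<lambda>v. inp v \<in> D) \<and> (\<forall>c\<in>H. rational_con N c \<and> nonstrict c))"

text \<open>A polytope is a compact polyhedron.\<close>

definition input_domain :: "network \<Rightarrow> (nat \<Rightarrow> real) set \<Rightarrow> bool" where
  "input_domain N D \<longleftrightarrow>
     compact D \<and> (rational_box (width N 0) D \<or> rational_polyhedron N D)"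

definition linear_region :: "network \<Rightarrow> (nat \<Rightarrow> real) set \<Rightarrow> bool" where
  "linear_region N R \<longleftrightarrow> R \<subseteq> Rvec (width N 0) \<and> (\<exists>H. encodes N H (\<lambda>v. inp v \<in> R))"

text \<open>The two cells of a partition may share boundary points, as in a split
  \<open>x\<^sub>k \<le> c\<close> / \<open>x\<^sub>k \<ge> c\<close>; disjoint cells are included.\<close>

definition partitions ::
  "network \<Rightarrow> (nat \<Rightarrow> real) set \<Rightarrow> (nat \<Rightarrow> real) set \<Rightarrow> (nat \<Rightarrow> real) set \<Rightarrow> bool" where
  "partitions N R R1 R2 \<longleftrightarrow> R = R1 \<union> R2 \<and> linear_region N R1 \<and> linear_region N R2"


section \<open>Exact semantics\<close>

type_synonym neuron = "nat \<times> nat"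

datatype phase = Active | Inactive

type_synonym assignment = "neuron \<Rightarrow> phase option"

definition relu_units :: "network \<Rightarrow> neuron set" where
  "relu_units N = {(i, j). 1 \<le> i \<and> i < depth N \<and> j < width N i}"

abbreviation pre :: "neuron \<Rightarrow> var" where
  "pre \<nu> \<equiv> Pre (fst \<nu>) (snd \<nu>)"

abbreviation post :: "neuron \<Rightarrow> var" where
  "post \<nu> \<equiv> Post (fst \<nu>) (snd \<nu>)"

fun phase_holds :: "phase \<Rightarrow> neuron \<Rightarrow> valuation \<Rightarrow> bool" where
  "phase_holds Active \<nu> v \<longleftrightarrow> v (post \<nu>) = v (pre \<nu>) \<and> v (pre \<nu>) \<ge> 0"
| "phase_holds Inactive \<nu> v \<longleftrightarrow> v (post \<nu>) = 0 \<and> v (pre \<nu>) \<le> 0"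

definition Exact :: "network \<Rightarrow> (nat \<Rightarrow> real) set \<Rightarrow> assignment \<Rightarrow> valuation set" where
  "Exact N R \<alpha> = {v \<in> valuations N.
     (\<forall>i\<in>{1..depth N}. \<forall>j<width N i.
        v (Pre i j) = (\<Sum>k<width N (i - 1). weight N i j k * v (Post (i - 1) k)) + bias N i j) \<and>
     (\<forall>\<nu>\<in>relu_units N. v (post \<nu>) = max 0 (v (pre \<nu>))) \<and>
     (\<forall>j<width N (depth N). v (Post (depth N) j) = v (Pre (depth N) j)) \<and>
     inp v \<in> R \<and>
     (\<forall>\<nu> p. \<alpha> \<nu> = Some p \<longrightarrow> phase_holds p \<nu> v)}"

datatype verdict = SAT "nat \<Rightarrow> real" | UNSAT | UNKNOWN


section \<open>ICL-Verifier\<close>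

definition affine_cons :: "network \<Rightarrow> lincon set" where
  "affine_cons N =
     {LC (\<lambda>w. case w of
            Pre i' j' \<Rightarrow> of_bool (i' = i \<and> j' = j)
          | Post i' k \<Rightarrow> if Suc i' = i then - weight N i j k else 0) Eq (bias N i j)
       |i j. i \<in> {1..depth N} \<and> j < width N i} \<union>
     {LC (\<lambda>w. of_bool (w = Post (depth N) j) - of_bool (w = Pre (depth N) j)) Eq 0
       |j. j < width N (depth N)}"

abbreviation pre_con :: "neuron \<Rightarrow> cmp \<Rightarrow> real \<Rightarrow> lincon" where
  "pre_con \<nu> r \<beta> \<equiv> LC (\<lambda>w. of_bool (w = pre \<nu>)) r \<beta>"

abbreviation post_con :: "neuron \<Rightarrow> cmp \<Rightarrow> real \<Rightarrow> lincon" where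
  "post_con \<nu> r \<beta> \<equiv> LC (\<lambda>w. of_bool (w = post \<nu>)) r \<beta>"

text \<open>\<open>z - a s\<close> compared with \<open>\<beta>\<close>.\<close>

abbreviation diff_con :: "neuron \<Rightarrow> real \<Rightarrow> cmp \<Rightarrow> real \<Rightarrow> lincon" where
  "diff_con \<nu> a r \<beta> \<equiv> LC (\<lambda>w. of_bool (w = post \<nu>) - a * of_bool (w = pre \<nu>)) r \<beta>"

fun phase_cons :: "phase \<Rightarrow> neuron \<Rightarrow> lincon set" where
  "phase_cons Active \<nu> = {diff_con \<nu> 1 Eq 0, pre_con \<nu> Ge 0}"
| "phase_cons Inactive \<nu> = {post_con \<nu> Eq 0, pre_con \<nu> Le 0}"

definition envelope :: "neuron \<Rightarrow> real \<Rightarrow> real \<Rightarrow> lincon set" where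
  "envelope \<nu> l u =
     {post_con \<nu> Ge 0, diff_con \<nu> 1 Ge 0,
      diff_con \<nu> (u / (u - l)) Le (- (u / (u - l) * l)), post_con \<nu> Le u}"

text \<open>A store consists of a base part and, for every ReLU unit, the constraints that propagation
  currently holds for this unit: the envelopes, or the specialization that has replaced them.\<close>

type_synonym store = "lincon set \<times> (neuron \<Rightarrow> lincon set)"

fun store_cons :: "store \<Rightarrow> lincon set" where
  "store_cons (B, E) = B \<union> (\<Union>\<nu>. E \<nu>)"

definition initial_store ::
  "network \<Rightarrow> lincon set \<Rightarrow> lincon set \<Rightarrow> lincon set \<Rightarrow> assignment \<Rightarrow> store" where
  "initial_store N \<Phi> H Learn \<alpha> =
     (affine_cons N \<union> H \<union> \<Phi> \<union> \<Union>{phase_cons p \<nu> |p \<nu>. \<alpha> \<nu> = Some p} \<union> Learn, \<lambda>_. {})"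

inductive prop_step :: "network \<Rightarrow> store \<Rightarrow> store \<Rightarrow> bool" for N where
  add_envelope:
    "\<lbrakk>\<nu> \<in> relu_units N;
      entails N (store_cons (B, E)) (pre_con \<nu> Ge l);
      entails N (store_cons (B, E)) (pre_con \<nu> Le u); l < 0; 0 < u\<rbrakk>
     \<Longrightarrow> prop_step N (B, E) (B, E(\<nu> := E \<nu> \<union> envelope \<nu> l u))"
| add_bound:
    "entails N (store_cons (B, E)) (LC g Le \<beta>)
     \<Longrightarrow> prop_step N (B, E) (insert (LC g Le \<beta>) B, E)"
| specialize_active:
    "\<lbrakk>\<nu> \<in> relu_units N; entails N (store_cons (B, E)) (pre_con \<nu> Ge 0)\<rbrakk>
     \<Longrightarrow> prop_step N (B, E) (B, E(\<nu> := phase_cons Active \<nu>))"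
| specialize_inactive:
    "\<lbrakk>\<nu> \<in> relu_units N; entails N (store_cons (B, E)) (pre_con \<nu> Le 0)\<rbrakk>
     \<Longrightarrow> prop_step N (B, E) (B, E(\<nu> := phase_cons Inactive \<nu>))"

definition propagated ::
  "network \<Rightarrow> lincon set \<Rightarrow> lincon set \<Rightarrow> (nat \<Rightarrow> real) set \<Rightarrow> assignment \<Rightarrow> lincon set \<Rightarrow> bool" where
  "propagated N \<Phi> Learn R \<alpha> C \<longleftrightarrow>
     (\<exists>H S. encodes N H (\<lambda>v. inp v \<in> R) \<and>
        (prop_step N)\<^sup>*\<^sup>* (initial_store N \<Phi> H Learn \<alpha>) S \<and> C = store_cons S)"

definition unstable :: "network \<Rightarrow> lincon set \<Rightarrow> neuron set" where
  "unstable N C = {\<nu> \<in> relu_units N.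
     \<not> entails N C (pre_con \<nu> Ge 0) \<and> \<not> entails N C (pre_con \<nu> Le 0)}"

definition exact_satisfiable :: "network \<Rightarrow> lincon set \<Rightarrow> neuron set \<Rightarrow> bool" where
  "exact_satisfiable N C T \<longleftrightarrow>
     (\<exists>v\<in>valuations N. sat N C v \<and> (\<forall>\<nu>\<in>T. v (post \<nu>) = max 0 (v (pre \<nu>))))"

type_synonym node = "(nat \<Rightarrow> real) set \<times> assignment"

inductive refines :: "network \<Rightarrow> node \<Rightarrow> node \<Rightarrow> node \<Rightarrow> bool" for N where
  split_region: "partitions N R R1 R2 \<Longrightarrow> refines N (R, \<alpha>) (R1, \<alpha>) (R2, \<alpha>)"
| split_phase: "\<lbrakk>\<nu> \<in> relu_units N; \<alpha> \<nu> = None\<rbrakk>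
    \<Longrightarrow> refines N (R, \<alpha>) (R, \<alpha>(\<nu> \<mapsto> Active)) (R, \<alpha>(\<nu> \<mapsto> Inactive))"

datatype icl_state = ICL_Run "lincon set" "node multiset" | ICL_Halt verdict

text \<open>One step processes one node (or learns a lemma). All choices the description leaves open
  (which node is popped, how far propagation goes, the point \<open>v\<close>, whether and on which units the
  exact check is run, how to refine, when resources run out) are nondeterministic.\<close>

inductive icl_step ::
  "network \<Rightarrow> (nat \<Rightarrow> real) set \<Rightarrow> ((nat \<Rightarrow> real) \<Rightarrow> bool) \<Rightarrow> lincon set \<Rightarrow> icl_state \<Rightarrow> icl_state \<Rightarrow> bool"
  for N D Safety \<Phi> where
  learn:
    "\<forall>v\<in>Exact N D Map.empty. holds N c v
     \<Longrightarrow> icl_step N D Safety \<Phi> (ICL_Run Learn Q) (ICL_Run (insert c Learn) Q)"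
| prune:
    "\<lbrakk>propagated N \<Phi> Learn R \<alpha> C; \<not> feasible N C\<rbrakk>
     \<Longrightarrow> icl_step N D Safety \<Phi> (ICL_Run Learn (add_mset (R, \<alpha>) Q)) (ICL_Run Learn Q)"
| counterexample:
    "\<lbrakk>propagated N \<Phi> Learn R \<alpha> C; v \<in> valuations N; sat N C v;
      inp v \<in> R; \<not> Safety (eval_net N (inp v))\<rbrakk>
     \<Longrightarrow> icl_step N D Safety \<Phi> (ICL_Run Learn (add_mset (R, \<alpha>) Q)) (ICL_Halt (SAT (inp v)))"
| exact_check:
    "\<lbrakk>propagated N \<Phi> Learn R \<alpha> C; v \<in> valuations N; sat N C v;
      \<not> (inp v \<in> R \<and> \<not> Safety (eval_net N (inp v)));
      T \<subseteq> unstable N C; \<not> exact_satisfiable N C T\<rbrakk>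
     \<Longrightarrow> icl_step N D Safety \<Phi> (ICL_Run Learn (add_mset (R, \<alpha>) Q)) (ICL_Run Learn Q)"
| refine:
    "\<lbrakk>propagated N \<Phi> Learn R \<alpha> C; v \<in> valuations N; sat N C v;
      \<not> (inp v \<in> R \<and> \<not> Safety (eval_net N (inp v)));
      refines N (R, \<alpha>) n1 n2\<rbrakk>
     \<Longrightarrow> icl_step N D Safety \<Phi> (ICL_Run Learn (add_mset (R, \<alpha>) Q))
           (ICL_Run Learn (add_mset n1 (add_mset n2 Q)))"
| finished: "icl_step N D Safety \<Phi> (ICL_Run Learn {#}) (ICL_Halt UNSAT)"
| out_of_resources:
    "Q \<noteq> {#} \<Longrightarrow> icl_step N D Safety \<Phi> (ICL_Run Learn Q) (ICL_Halt UNKNOWN)"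

definition ICL_returns ::
  "network \<Rightarrow> (nat \<Rightarrow> real) set \<Rightarrow> ((nat \<Rightarrow> real) \<Rightarrow> bool) \<Rightarrow> lincon set \<Rightarrow> verdict \<Rightarrow> bool" where
  "ICL_returns N D Safety \<Phi> r \<longleftrightarrow>
     (icl_step N D Safety \<Phi>)\<^sup>*\<^sup>* (ICL_Run {} {#(D, Map.empty)#}) (ICL_Halt r)"


section \<open>HSRV\<close>

text \<open>Learned constraints are not required to be linear here, so they are arbitrary predicates.\<close>

type_synonym constraint = "valuation \<Rightarrow> bool"

definition sound_bounds ::
  "network \<Rightarrow> (nat \<Rightarrow> real) set \<Rightarrow> (neuron \<Rightarrow> real) \<Rightarrow> (neuron \<Rightarrow> real) \<Rightarrow> bool" where
  "sound_bounds N R l u \<longleftrightarrow> (\<forall>v\<in>Exact N R Map.empty. \<forall>i\<in>{1..depth N}. \<forall>j<width N i.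
     l (i, j) \<le> v (Pre i j) \<and> v (Pre i j) \<le> u (i, j))"

definition sound_relaxation :: "network \<Rightarrow> (nat \<Rightarrow> real) set \<Rightarrow> lincon set \<Rightarrow> bool" where
  "sound_relaxation N R C \<longleftrightarrow> finite C \<and> (\<forall>v\<in>Exact N R Map.empty. sat N C v)"

definition implies_safety ::
  "network \<Rightarrow> ((nat \<Rightarrow> real) \<Rightarrow> bool) \<Rightarrow> (nat \<Rightarrow> real) set \<Rightarrow> lincon set \<Rightarrow> bool" where
  "implies_safety N Safety R C \<longleftrightarrow>
     (\<forall>v\<in>valuations N. inp v \<in> R \<and> sat N C v \<longrightarrow> Safety (outp N v))"

definition exact_query ::
  "network \<Rightarrow> ((nat \<Rightarrow> real) \<Rightarrow> bool) \<Rightarrow> (nat \<Rightarrow> real) set \<Rightarrow> constraint set \<Rightarrow> valuation set" where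
  "exact_query N Safety R L =
     {v \<in> Exact N R Map.empty. \<not> Safety (outp N v) \<and> (\<forall>c\<in>L. c v)}"

datatype answer = Ans_Sat valuation | Ans_Unsat | Ans_Unknown

text \<open>The first argument is the set of solutions of the query.\<close>

fun correct_answer :: "valuation set \<Rightarrow> answer \<Rightarrow> bool" where
  "correct_answer F (Ans_Sat v) \<longleftrightarrow> v \<in> F"
| "correct_answer F Ans_Unsat \<longleftrightarrow> F = {}"
| "correct_answer F Ans_Unknown \<longleftrightarrow> True"

text \<open>Outcome of processing a region up to and including the solver call, when the relaxation
  does not suffice.\<close>

definition solver_answers :: "network \<Rightarrow> ((nat \<Rightarrow> real) \<Rightarrow> bool) \<Rightarrow> (nat \<Rightarrow> real) set \<Rightarrow>
    constraint set \<Rightarrow> answer \<Rightarrow> bool" where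
  "solver_answers N Safety R L a \<longleftrightarrow>
     (\<exists>l u C. sound_bounds N R l u \<and> sound_relaxation N R C \<and> \<not> implies_safety N Safety R C) \<and>
     correct_answer (exact_query N Safety R L) a"

datatype hsrv_state =
  HSRV_Run "constraint set" "(nat \<Rightarrow> real) set multiset" | HSRV_Halt verdict

inductive hsrv_step ::
  "network \<Rightarrow> (nat \<Rightarrow> real) set \<Rightarrow> ((nat \<Rightarrow> real) \<Rightarrow> bool) \<Rightarrow> hsrv_state \<Rightarrow> hsrv_state \<Rightarrow> bool"
  for N D Safety where
  learn:
    "\<forall>v\<in>Exact N D Map.empty. c v
     \<Longrightarrow> hsrv_step N D Safety (HSRV_Run L Q) (HSRV_Run (insert c L) Q)"
| relaxation_safe:
    "\<lbrakk>sound_bounds N R l u; sound_relaxation N R C; implies_safety N Safety R C\<rbrakk>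
     \<Longrightarrow> hsrv_step N D Safety (HSRV_Run L (add_mset R Q)) (HSRV_Run L Q)"
| solver_sat:
    "solver_answers N Safety R L (Ans_Sat v)
     \<Longrightarrow> hsrv_step N D Safety (HSRV_Run L (add_mset R Q)) (HSRV_Halt (SAT (inp v)))"
| solver_unsat:
    "solver_answers N Safety R L Ans_Unsat
     \<Longrightarrow> hsrv_step N D Safety (HSRV_Run L (add_mset R Q)) (HSRV_Run L Q)"
| solver_unknown:
    "\<lbrakk>solver_answers N Safety R L Ans_Unknown; partitions N R R1 R2\<rbrakk>
     \<Longrightarrow> hsrv_step N D Safety (HSRV_Run L (add_mset R Q))
           (HSRV_Run L (add_mset R1 (add_mset R2 Q)))"
| finished: "hsrv_step N D Safety (HSRV_Run L {#}) (HSRV_Halt UNSAT)"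

text \<open>The initial set of learned constraints may be any set of valid constraints.\<close>

definition HSRV_returns ::
  "network \<Rightarrow> (nat \<Rightarrow> real) set \<Rightarrow> ((nat \<Rightarrow> real) \<Rightarrow> bool) \<Rightarrow> verdict \<Rightarrow> bool" where
  "HSRV_returns N D Safety r \<longleftrightarrow>
     (\<exists>L. (\<forall>c\<in>L. \<forall>v\<in>Exact N D Map.empty. c v) \<and>
        (hsrv_step N D Safety)\<^sup>*\<^sup>* (HSRV_Run L {#D#}) (HSRV_Halt r))"

end

theory Submission
  imports Defs
begin

text \<open>Exact executions of the network are determined by their input, and every \<open>x \<in> D\<close> has one.
  Propagation only adds constraints that hold on all exact executions of the node, so a node that
  is discarded contains no unsafe execution, and a refined node passes each of its executions on to
  a child. Hence every unsafe execution over \<open>D\<close> stays in some node of the worklist, which must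
  therefore be nonempty if one exists. Witnesses are sound because all regions remain inside \<open>D\<close>.\<close>

section \<open>Exact executions\<close>

lemma valuationsD: "v \<in> valuations N \<Longrightarrow> u \<notin> vars N \<Longrightarrow> v u = 0"
  by (simp add: valuations_def)

lemma finite_vars: "finite (vars N)"
proof -
  have "vars N \<subseteq> (\<lambda>k. Post 0 k) ` {..<width N 0} \<union>
      (\<lambda>(i, j). Pre i j) ` (SIGMA i:{1..depth N}. {..<width N i}) \<union>
      (\<lambda>(i, j). Post i j) ` (SIGMA i:{1..depth N}. {..<width N i})"
    by (fastforce simp: vars_def)
  then show ?thesis
    by (rule finite_subset) (intro finite_UnI finite_imageI finite_SigmaI finite_lessThan finite_atLeastAtMost)
qed

lemma Post_in_vars: "Post i k \<in> vars N \<longleftrightarrow> i \<le> depth N \<and> k < width N i"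
  by (cases "i = 0") (auto simp: vars_def)

lemma Pre_in_vars: "Pre i j \<in> vars N \<longleftrightarrow> i \<in> {1..depth N} \<and> j < width N i"
  by (auto simp: vars_def)

lemma ExactD:
  assumes "v \<in> Exact N R \<alpha>"
  shows "v \<in> valuations N"
    and "\<And>i j. \<lbrakk>i \<in> {1..depth N}; j < width N i\<rbrakk> \<Longrightarrow>
      v (Pre i j) = (\<Sum>k<width N (i - 1). weight N i j k * v (Post (i - 1) k)) + bias N i j"
    and "\<And>\<nu>. \<nu> \<in> relu_units N \<Longrightarrow> v (post \<nu>) = max 0 (v (pre \<nu>))"
    and "\<And>j. j < width N (depth N) \<Longrightarrow> v (Post (depth N) j) = v (Pre (depth N) j)"
    and "inp v \<in> R"
    and "\<And>\<nu> p. \<alpha> \<nu> = Some p \<Longrightarrow> phase_holds p \<nu> v"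
  using assms by (auto simp: Exact_def)

lemma Exact_Un: "Exact N (R1 \<union> R2) \<alpha> = Exact N R1 \<alpha> \<union> Exact N R2 \<alpha>"
  by (auto simp: Exact_def)

text \<open>The sign of the pre-activation decides the phase; at 0 both phases hold.\<close>

lemma Exact_split_phase:
  assumes "\<nu> \<in> relu_units N" "v \<in> Exact N R \<alpha>"
  shows "v \<in> Exact N R (\<alpha>(\<nu> \<mapsto> Active)) \<or> v \<in> Exact N R (\<alpha>(\<nu> \<mapsto> Inactive))"
proof -
  have "phase_holds Active \<nu> v \<or> phase_holds Inactive \<nu> v"
    using ExactD(3)[OF assms(2,1)] by auto
  then show ?thesis
    using assms(2) by (auto simp: Exact_def)
qed

text \<open>Induction along the layers: each affine and activation equation fixes the next values
  from the previous ones, so only the input is free.\<close>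

lemma Exact_Post_eq_layer:
  assumes "v \<in> Exact N R \<alpha>" "i \<le> depth N"
  shows "v (Post i k) = layer N (inp v) i k"
  using assms(2)
proof (induction i arbitrary: k)
  case 0
  then show ?case by (simp add: inp_def)
next
  case (Suc i)
  show ?case
  proof (cases "k < width N (Suc i)")
    case True
    have pre: "v (Pre (Suc i) k)
        = (\<Sum>m<width N i. weight N (Suc i) k m * layer N (inp v) i m) + bias N (Suc i) k"
      using ExactD(2)[OF assms(1), of "Suc i" k] Suc True by simp
    show ?thesis
    proof (cases "Suc i < depth N")
      case hidden: True
      then have "(Suc i, k) \<in> relu_units N"
        using True by (simp add: relu_units_def)
      from ExactD(3)[OF assms(1) this] show ?thesis
        using hidden True pre by (simp add: Let_def)
    next
      case False
      then have "Suc i = depth N" using Suc.prems by simp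
      with ExactD(4)[OF assms(1), of k] have "v (Post (Suc i) k) = v (Pre (Suc i) k)"
        using True by simp
      with False True pre show ?thesis
        by (simp add: Let_def)
    qed
  next
    \<comment> \<open>Indices beyond the width carry the default value 0 on both sides.\<close>
    case False
    then show ?thesis
      using valuationsD[OF ExactD(1)[OF assms(1)], of "Post (Suc i) k"]
      by (simp add: Post_in_vars)
  qed
qed

lemma outp_Exact: "v \<in> Exact N R \<alpha> \<Longrightarrow> outp N v = eval_net N (inp v)"
  by (simp add: outp_def eval_net_def Exact_Post_eq_layer)

text \<open>The forward pass on \<open>x\<close> is the witness. \<open>depth N \<ge> 1\<close>
  separates the output layer from the input, and \<open>x \<in> Rvec (width N 0)\<close> makes the
  input part vanish outside the variables.\<close>

lemma exists_Exact:
  assumes "depth N \<ge> 1" "x \<in> D" "x \<in> Rvec (width N 0)"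
  obtains v where "v \<in> Exact N D Map.empty" "inp v = x"
proof
  let ?v = "\<lambda>u. case u of
      Post i k \<Rightarrow> if i \<le> depth N then layer N x i k else 0
    | Pre i j \<Rightarrow> if i \<in> {1..depth N} \<and> j < width N i
        then (\<Sum>k<width N (i - 1). weight N i j k * layer N x (i - 1) k) + bias N i j else 0"
  show inp: "inp ?v = x"
    by (simp add: inp_def)
  have "layer N x i k = 0" if "k \<ge> width N i" for i k
    using that assms(3) by (cases i) (auto simp: Rvec_def)
  then have val: "?v \<in> valuations N"
    by (auto simp: valuations_def Post_in_vars Pre_in_vars split: var.split)
  \<comment> \<open>One equation for hidden and output layers; \<open>relu\<close> and
    \<open>out\<close> below are its two branches.\<close>
  have step: "layer N x i j = (if i < depth N then max 0 (?v (Pre i j)) else ?v (Pre i j))"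
    if "i \<in> {1..depth N}" "j < width N i" for i j
  proof -
    from that obtain m where m: "i = Suc m" by (cases i) auto
    have "?v (Pre i j) = (\<Sum>k<width N m. weight N i j k * layer N x m k) + bias N i j"
      using that by (simp add: m)
    then show ?thesis
      using that(2) by (simp only: m layer.simps(2) Let_def if_True)
  qed
  have relu: "?v (post \<nu>) = max 0 (?v (pre \<nu>))" if "\<nu> \<in> relu_units N" for \<nu>
    using that step[of "fst \<nu>" "snd \<nu>"] by (auto simp: relu_units_def)
  have out: "?v (Post (depth N) j) = ?v (Pre (depth N) j)" if "j < width N (depth N)" for j
    using that step[of "depth N" j] assms(1) by simp
  show "?v \<in> Exact N D Map.empty"
    unfolding Exact_def
  proof (intro CollectI conjI ballI allI impI)
    fix i j
    assume "i \<in> {1..depth N}" "j < width N i"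
    then show "?v (Pre i j)
        = (\<Sum>k<width N (i - 1). weight N i j k * ?v (Post (i - 1) k)) + bias N i j"
      by (simp add: le_diff_conv)
  qed (use val relu out inp assms(2) in \<open>simp_all only: option.distinct\<close>)
qed

lemma input_domain_subset_Rvec: "input_domain N D \<Longrightarrow> D \<subseteq> Rvec (width N 0)"
  by (auto simp: input_domain_def rational_box_def rational_polyhedron_def)

section \<open>Soundness of propagation\<close>

text \<open>For \<open>u\<close> outside \<open>vars N\<close> no summand survives, and
  \<open>v u\<close> is 0 as well.\<close>

lemma sum_of_bool_var:
  assumes "v \<in> valuations N"
  shows "(\<Sum>w\<in>vars N. of_bool (w = u) * v w) = v u"
proof -
  have "(\<Sum>w\<in>vars N. of_bool (w = u) * v w) = (\<Sum>w\<in>vars N. if w = u then v w else 0)"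
    by (rule sum.cong) auto
  then show ?thesis
    using valuationsD[OF assms] by (simp add: finite_vars)
qed

lemma holds_pre_con: "v \<in> valuations N \<Longrightarrow> holds N (pre_con \<nu> r \<beta>) v \<longleftrightarrow> compare r (v (pre \<nu>)) \<beta>"
  by (simp only: holds.simps sum_of_bool_var)

lemma holds_post_con: "v \<in> valuations N \<Longrightarrow> holds N (post_con \<nu> r \<beta>) v \<longleftrightarrow> compare r (v (post \<nu>)) \<beta>"
  by (simp only: holds.simps sum_of_bool_var)

lemma sum_diff_var:
  assumes "v \<in> valuations N"
  shows "(\<Sum>w\<in>vars N. (of_bool (w = p) - a * of_bool (w = q)) * v w) = v p - a * v q"
  by (simp only: left_diff_distrib mult.assoc sum_subtractf sum_distrib_left[symmetric]
      sum_of_bool_var[OF assms])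

lemma holds_diff_con:
  "v \<in> valuations N \<Longrightarrow>
   holds N (diff_con \<nu> a r \<beta>) v \<longleftrightarrow> compare r (v (post \<nu>) - a * v (pre \<nu>)) \<beta>"
  by (simp only: holds.simps sum_diff_var)

lemma sat_phase_cons:
  assumes "v \<in> valuations N" "phase_holds p \<nu> v"
  shows "sat N (phase_cons p \<nu>) v"
  using assms(2)
  \<comment> \<open>Simplification removes the factor 1 in \<open>diff_con \<nu> 1\<close>, so the
    evaluation rule is brought into the same form.\<close>
  by (cases p) (simp_all add: sat_def holds_pre_con[OF assms(1)] holds_post_con[OF assms(1)]
      holds_diff_con[OF assms(1), where a = 1, unfolded mult_1] del: holds.simps)

text \<open>On \<open>[l, u]\<close> the ReLU is convex, so its graph lies below the chord from
  \<open>(l, 0)\<close> to \<open>(u, u)\<close>; this chord is the third constraint, and the others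
  are immediate.\<close>

lemma sat_envelope:
  assumes "v \<in> valuations N" "v (post \<nu>) = max 0 (v (pre \<nu>))"
    and "l \<le> v (pre \<nu>)" "v (pre \<nu>) \<le> u" "l < 0" "0 < u"
  shows "sat N (envelope \<nu> l u) v"
proof -
  let ?s = "v (pre \<nu>)"
  \<comment> \<open>The chord bound multiplied by \<open>u - l\<close>. For
    \<open>?s \<ge> 0\<close> it amounts to \<open>u * l \<le> ?s * l\<close>; otherwise the left
    side is 0.\<close>
  have "max 0 ?s * (u - l) \<le> u * (?s - l)"
  proof (cases "?s \<ge> 0")
    case True
    have "u * l \<le> ?s * l"
      using assms by (intro mult_right_mono_neg) auto
    then show ?thesis
      using True by (simp add: algebra_simps)
  next
    case False
    then show ?thesis
      using assms by simp
  qed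
  moreover have "0 < u - l"
    using assms by simp
  ultimately have "max 0 ?s \<le> u * (?s - l) / (u - l)"
    by (simp only: pos_le_divide_eq)
  \<comment> \<open>\<open>a\<close> is the slope of the chord; naming it lets the bound be matched
    with the form used in \<open>envelope\<close>.\<close>
  moreover define a where "a = u / (u - l)"
  ultimately have "max 0 ?s - a * ?s \<le> - (a * l)"
    by (simp add: algebra_simps diff_divide_distrib)
  then show ?thesis
    using assms(2-) unfolding sat_def envelope_def a_def[symmetric]
    by (simp add: holds_post_con[OF assms(1)]
        holds_diff_con[OF assms(1)] holds_diff_con[OF assms(1), where a = 1, unfolded mult_1]
        del: holds.simps)
qed

lemma sat_affine_cons:
  assumes "v \<in> Exact N R \<alpha>"
  shows "sat N (affine_cons N) v"
proof -
  note val = ExactD(1)[OF assms]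
  have "holds N (LC (\<lambda>w. case w of
            Pre i' j' \<Rightarrow> of_bool (i' = i \<and> j' = j)
          | Post i' k \<Rightarrow> if Suc i' = i then - weight N i j k else 0) Eq (bias N i j)) v"
    if ij: "i \<in> {1..depth N}" "j < width N i" for i j
  proof -
    let ?g = "\<lambda>w. case w of
            Pre i' j' \<Rightarrow> of_bool (i' = i \<and> j' = j)
          | Post i' k \<Rightarrow> if Suc i' = i then - weight N i j k else 0"
    let ?P = "Post (i - 1) ` {..<width N (i - 1)}"
    \<comment> \<open>Among the variables, only \<open>Pre i j\<close> and the outputs of layer
      \<open>i - 1\<close> can have a nonzero coefficient.\<close>
    have "(\<Sum>w\<in>vars N. ?g w * v w) = (\<Sum>w\<in>insert (Pre i j) ?P. ?g w * v w)"
      using ij by (intro sum.mono_neutral_right)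
        (auto simp: finite_vars Post_in_vars Pre_in_vars split: var.splits)
    also have "\<dots> = v (Pre i j) + (\<Sum>w\<in>?P. ?g w * v w)"
      by (subst sum.insert) auto
    also have "(\<Sum>w\<in>?P. ?g w * v w)
        = - (\<Sum>k<width N (i - 1). weight N i j k * v (Post (i - 1) k))"
      using ij by (subst sum.reindex) (auto simp: inj_on_def sum_negf)
    also have "v (Pre i j) + \<dots> = bias N i j"
      using ExactD(2)[OF assms ij] by simp
    finally show ?thesis
      by simp
  qed
  moreover have "holds N (LC (\<lambda>w. of_bool (w = Post (depth N) j) - of_bool (w = Pre (depth N) j)) Eq 0) v"
    if "j < width N (depth N)" for j
    using sum_diff_var[OF val, of "Post (depth N) j" 1 "Pre (depth N) j"] ExactD(4)[OF assms that]
    by simp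
  ultimately show ?thesis
    unfolding sat_def affine_cons_def by blast
qed

text \<open>The bounds that license a step are entailed by the store, hence true at
  \<open>v\<close>; under them the new constraints follow from the ReLU equation of the
  unit.\<close>

lemma prop_step_sound:
  assumes "prop_step N S S'" "v \<in> valuations N"
    and relu: "\<And>\<nu>. \<nu> \<in> relu_units N \<Longrightarrow> v (post \<nu>) = max 0 (v (pre \<nu>))"
    and sat: "sat N (store_cons S) v"
  shows "sat N (store_cons S') v"
proof -
  have ent: "holds N c v" if "entails N (store_cons S) c" for c
    using that assms(2) sat by (simp add: entails_def)
  \<comment> \<open>Replacing the constraints of one unit is harmless: those of the other units are
    untouched, and \<open>F\<close> holds by itself.\<close>
  have upd: "sat N (store_cons (B, E(\<nu> := F))) v"
    if "S = (B, E)" "sat N F v" for B E F and \<nu> :: neuron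
    using that sat by (auto simp: sat_def split: if_splits)
  show ?thesis
    using assms(1)
  proof cases
    case (add_envelope \<nu> B E l u)
    have "l \<le> v (pre \<nu>)" "v (pre \<nu>) \<le> u"
      using ent[of "pre_con \<nu> Ge l"] ent[of "pre_con \<nu> Le u"] add_envelope(1,4,5)
      by (simp_all add: holds_pre_con[OF assms(2)] del: holds.simps)
    then have "sat N (envelope \<nu> l u) v"
      using relu add_envelope(3,6,7) by (intro sat_envelope assms(2))
    then have "sat N (E \<nu> \<union> envelope \<nu> l u) v"
      using sat add_envelope(1) by (auto simp: sat_def)
    then show ?thesis
      using upd[OF add_envelope(1)] add_envelope(2) by blast
  next
    case (add_bound B E g \<beta>)
    then show ?thesis
      using ent[of "LC g Le \<beta>"] sat by (auto simp: sat_def)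
  next
    case (specialize_active \<nu> B E)
    have "v (pre \<nu>) \<ge> 0"
      using ent[of "pre_con \<nu> Ge 0"] specialize_active holds_pre_con[OF assms(2), of \<nu> Ge 0]
      by (simp del: holds.simps)
    then have "sat N (phase_cons Active \<nu>) v"
      using relu[OF specialize_active(3)] by (intro sat_phase_cons assms(2)) simp
    then show ?thesis
      using upd[OF specialize_active(1)] specialize_active(2) by blast
  next
    case (specialize_inactive \<nu> B E)
    have "v (pre \<nu>) \<le> 0"
      using ent[of "pre_con \<nu> Le 0"] specialize_inactive holds_pre_con[OF assms(2), of \<nu> Le 0]
      by (simp del: holds.simps)
    then have "sat N (phase_cons Inactive \<nu>) v"
      using relu[OF specialize_inactive(3)] by (intro sat_phase_cons assms(2)) simp
    then show ?thesis
      using upd[OF specialize_inactive(1)] specialize_inactive(2) by blast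
  qed
qed

text \<open>Region and phase constraints hold by membership in \<open>Exact N R \<alpha>\<close>.
  \<open>\<Phi>\<close> has to be assumed, since a safe execution violates it.\<close>

lemma propagated_sound:
  assumes "propagated N \<Phi> Learn R \<alpha> C" "v \<in> Exact N R \<alpha>" "sat N \<Phi> v" "sat N Learn v"
  shows "sat N C v"
proof -
  obtain H S where H: "encodes N H (\<lambda>v. inp v \<in> R)"
    and steps: "(prop_step N)\<^sup>*\<^sup>* (initial_store N \<Phi> H Learn \<alpha>) S" and C: "C = store_cons S"
    using assms(1) unfolding propagated_def by blast
  note ex = ExactD[OF assms(2)]
  have "sat N H v"
    using H ex(1,5) by (simp add: encodes_def)
  moreover have "sat N (\<Union>{phase_cons p \<nu> |p \<nu>. \<alpha> \<nu> = Some p}) v"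
    using sat_phase_cons[OF ex(1) ex(6)] unfolding sat_def by blast
  ultimately have "sat N (store_cons (initial_store N \<Phi> H Learn \<alpha>)) v"
    using sat_affine_cons[OF assms(2)] assms(3,4)
    unfolding initial_store_def sat_def store_cons.simps by blast
  with steps have "sat N (store_cons S) v"
    by (induction rule: rtranclp_induct) (use prop_step_sound ex(1,3) in blast)+
  then show ?thesis
    by (simp add: C)
qed

section \<open>The worklist invariants\<close>

lemma refines_cover:
  assumes "refines N (R, \<alpha>) (R1, \<alpha>1) (R2, \<alpha>2)" "v \<in> Exact N R \<alpha>"
  shows "v \<in> Exact N R1 \<alpha>1 \<or> v \<in> Exact N R2 \<alpha>2"
  using assms(1)
proof cases
  case split_region
  then show ?thesis using assms(2) by (auto simp: partitions_def Exact_Un)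
next
  case (split_phase \<nu>)
  then show ?thesis using Exact_split_phase[OF _ assms(2)] by blast
qed

text \<open>Keeps all regions inside \<open>D\<close>, as the witness of a SAT verdict
  requires.\<close>

lemma refines_subset:
  assumes "refines N (R, \<alpha>) (R1, \<alpha>1) (R2, \<alpha>2)"
  shows "R1 \<subseteq> R \<and> R2 \<subseteq> R"
  using assms by cases (auto simp: partitions_def)

section \<open>Unsafe executions and sound verdicts\<close>

definition unsafe_execs :: "network \<Rightarrow> (nat \<Rightarrow> real) set \<Rightarrow> ((nat \<Rightarrow> real) \<Rightarrow> bool) \<Rightarrow> valuation set" where
  "unsafe_execs N D Safety = {v \<in> Exact N D Map.empty. \<not> Safety (outp N v)}"

text \<open>UNSAT is expressed through executions rather than inputs, because executions are what
  the worklist covers.\<close>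

fun sound_verdict ::
  "network \<Rightarrow> (nat \<Rightarrow> real) set \<Rightarrow> ((nat \<Rightarrow> real) \<Rightarrow> bool) \<Rightarrow> verdict \<Rightarrow> bool" where
  "sound_verdict N D Safety (SAT x) \<longleftrightarrow> x \<in> D \<and> \<not> Safety (eval_net N x)"
| "sound_verdict N D Safety UNSAT \<longleftrightarrow> unsafe_execs N D Safety = {}"
| "sound_verdict N D Safety UNKNOWN \<longleftrightarrow> True"

text \<open>Passes from executions to inputs: an unsafe input would extend to an unsafe
  execution.\<close>

lemma sound_UNSAT_safe:
  assumes "wf_network N" "input_domain N D" "sound_verdict N D Safety UNSAT" "x \<in> D"
  shows "Safety (eval_net N x)"
proof -
  obtain v where "v \<in> Exact N D Map.empty" "inp v = x"
    using exists_Exact assms(1,2,4) input_domain_subset_Rvec wf_network_def by blast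
  with assms(3) show ?thesis
    by (auto simp: unsafe_execs_def outp_Exact)
qed

section \<open>The invariant of ICL-Verifier\<close>

fun icl_inv ::
  "network \<Rightarrow> (nat \<Rightarrow> real) set \<Rightarrow> ((nat \<Rightarrow> real) \<Rightarrow> bool) \<Rightarrow> icl_state \<Rightarrow> bool" where
  "icl_inv N D Safety (ICL_Run Learn Q) \<longleftrightarrow>
     (\<forall>v\<in>Exact N D Map.empty. sat N Learn v) \<and>
     (\<forall>(R, \<alpha>)\<in>#Q. R \<subseteq> D) \<and>
     (\<forall>v\<in>unsafe_execs N D Safety. \<exists>(R, \<alpha>)\<in>#Q. v \<in> Exact N R \<alpha>)"
| "icl_inv N D Safety (ICL_Halt r) \<longleftrightarrow> sound_verdict N D Safety r"

lemma icl_inv_step: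
  assumes enc: "encodes N \<Phi> (\<lambda>v. \<not> Safety (outp N v))"
    and "icl_step N D Safety \<Phi> s s'" "icl_inv N D Safety s"
  shows "icl_inv N D Safety s'"
proof -
  \<comment> \<open>An unsafe execution satisfies \<open>\<Phi>\<close> by the encoding, and the
    lemmas because it is an execution over \<open>D\<close> without phases.\<close>
  have sound: "sat N C v"
    if "propagated N \<Phi> Learn R \<alpha> C" "v \<in> Exact N R \<alpha>" "v \<in> unsafe_execs N D Safety"
      "\<forall>v\<in>Exact N D Map.empty. sat N Learn v" for Learn R \<alpha> C v
    using that enc ExactD(1)[OF that(2)]
    by (intro propagated_sound[OF that(1,2)]) (auto simp: unsafe_execs_def encodes_def)
  show ?thesis
    using assms(2)
  proof cases
    case (learn c Learn Q)
    then show ?thesis using assms(3) by (auto simp: sat_def)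
  next
    case (prune Learn R \<alpha> C Q)
    \<comment> \<open>Such a \<open>v\<close> would be a feasible point of \<open>C\<close>.\<close>
    have "v \<notin> Exact N R \<alpha>" if "v \<in> unsafe_execs N D Safety" for v
      using prune sound[OF prune(3) _ that] assms(3) ExactD(1)
      by (fastforce simp: feasible_def)
    then show ?thesis using prune assms(3) by fastforce
  next
    case (counterexample Learn R \<alpha> C v Q)
    \<comment> \<open>The network was evaluated at \<open>inp v\<close> itself, so the witness is
      genuine even if \<open>v\<close> is not an exact execution.\<close>
    then show ?thesis using assms(3) by auto
  next
    case (exact_check Learn R \<alpha> C v T Q)
    \<comment> \<open>The check imposes ReLU semantics only on \<open>T\<close>; an execution obeys
      it on all units and would therefore be a solution.\<close>
    have "w \<notin> Exact N R \<alpha>" if w: "w \<in> unsafe_execs N D Safety" for w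
    proof
      assume ex: "w \<in> Exact N R \<alpha>"
      have "T \<subseteq> relu_units N"
        using exact_check by (auto simp: unstable_def)
      then have "\<forall>\<nu>\<in>T. w (post \<nu>) = max 0 (w (pre \<nu>))"
        using ExactD(3)[OF ex] by blast
      moreover have "sat N C w"
        using sound[OF exact_check(3) ex w] assms(3) exact_check(1) by simp
      ultimately have "exact_satisfiable N C T"
        using ExactD(1)[OF ex] unfolding exact_satisfiable_def by blast
      then show False using exact_check by simp
    qed
    then show ?thesis using exact_check assms(3) by fastforce
  next
    case (refine Learn R \<alpha> C v n1 n2 Q)
    obtain R1 \<alpha>1 R2 \<alpha>2 where n: "n1 = (R1, \<alpha>1)" "n2 = (R2, \<alpha>2)"
      by (cases n1, cases n2)
    have children: "refines N (R, \<alpha>) (R1, \<alpha>1) (R2, \<alpha>2)"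
      using refine(7) by (simp add: n)
    have "R1 \<subseteq> D" "R2 \<subseteq> D"
      using refines_subset[OF children] assms(3) refine(1) by auto
    \<comment> \<open>Executions covered by the popped node move to a child; the others are still
      covered by \<open>Q\<close>.\<close>
    moreover have "v \<in> Exact N R1 \<alpha>1 \<or> v \<in> Exact N R2 \<alpha>2 \<or> (\<exists>(R, \<alpha>)\<in>#Q. v \<in> Exact N R \<alpha>)"
      if "v \<in> unsafe_execs N D Safety" for v
      using refines_cover[OF children, of v] assms(3) refine(1) that by auto
    ultimately show ?thesis
      using assms(3) refine(1) by (simp add: refine(2) n)
  next
    case (finished Learn)
    then show ?thesis using assms(3) by auto
  next
    case (out_of_resources Q Learn)
    then show ?thesis by simp
  qed
qed

lemma ICL_returns_sound:
  assumes "encodes N \<Phi> (\<lambda>v. \<not> Safety (outp N v))" "ICL_returns N D Safety \<Phi> r"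
  shows "sound_verdict N D Safety r"
proof -
  have "(icl_step N D Safety \<Phi>)\<^sup>*\<^sup>* (ICL_Run {} {#(D, Map.empty)#}) (ICL_Halt r)"
    using assms(2) by (simp add: ICL_returns_def)
  then have "icl_inv N D Safety (ICL_Halt r)"
  proof (induction rule: rtranclp_induct)
    case base
    show ?case by (simp add: sat_def unsafe_execs_def)
  next
    case (step s s')
    then show ?case using icl_inv_step[OF assms(1)] by blast
  qed
  then show ?thesis by simp
qed

section \<open>The invariant of HSRV\<close>

fun hsrv_inv ::
  "network \<Rightarrow> (nat \<Rightarrow> real) set \<Rightarrow> ((nat \<Rightarrow> real) \<Rightarrow> bool) \<Rightarrow> hsrv_state \<Rightarrow> bool" where
  "hsrv_inv N D Safety (HSRV_Run L Q) \<longleftrightarrow>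
     (\<forall>c\<in>L. \<forall>v\<in>Exact N D Map.empty. c v) \<and>
     (\<forall>R\<in>#Q. R \<subseteq> D) \<and>
     (\<forall>v\<in>unsafe_execs N D Safety. \<exists>R\<in>#Q. v \<in> Exact N R Map.empty)"
| "hsrv_inv N D Safety (HSRV_Halt r) \<longleftrightarrow> sound_verdict N D Safety r"

lemma hsrv_inv_step:
  assumes "hsrv_step N D Safety s s'" "hsrv_inv N D Safety s"
  shows "hsrv_inv N D Safety s'"
  using assms(1)
proof cases
  case (learn c L Q)
  then show ?thesis using assms(2) by auto
next
  case (relaxation_safe R l u C L Q)
  \<comment> \<open>An execution over \<open>R\<close> satisfies the relaxation, so its output would
    be safe.\<close>
  have "v \<notin> Exact N R Map.empty" if "v \<in> unsafe_execs N D Safety" for v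
    using relaxation_safe that ExactD(1,5)[of v N R Map.empty]
    by (auto simp: sound_relaxation_def implies_safety_def unsafe_execs_def)
  then show ?thesis using relaxation_safe assms(2) by fastforce
next
  case (solver_sat R L v Q)
  then have "v \<in> Exact N R Map.empty" "\<not> Safety (outp N v)" "R \<subseteq> D"
    using assms(2) by (auto simp: solver_answers_def exact_query_def)
  \<comment> \<open>The model is an exact execution, so its output variables carry the value of the
    network at its input.\<close>
  then show ?thesis using solver_sat ExactD(5) by (auto simp: outp_Exact)
next
  case (solver_unsat R L Q)
  \<comment> \<open>Being an execution over \<open>D\<close>, \<open>v\<close> satisfies all of
    \<open>L\<close>, and would thus solve the query.\<close>
  have "v \<notin> Exact N R Map.empty" if "v \<in> unsafe_execs N D Safety" for v
    using solver_unsat that assms(2)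
    by (fastforce simp: solver_answers_def exact_query_def unsafe_execs_def)
  then show ?thesis using solver_unsat assms(2) by fastforce
next
  case (solver_unknown R L R1 R2 Q)
  then have "R = R1 \<union> R2" by (simp add: partitions_def)
  then show ?thesis using solver_unknown assms(2) by (fastforce simp: Exact_Un)
next
  case (finished L)
  then show ?thesis using assms(2) by auto
qed

lemma HSRV_returns_sound:
  assumes "HSRV_returns N D Safety r"
  shows "sound_verdict N D Safety r"
proof -
  obtain L where L: "\<forall>c\<in>L. \<forall>v\<in>Exact N D Map.empty. c v"
    and "(hsrv_step N D Safety)\<^sup>*\<^sup>* (HSRV_Run L {#D#}) (HSRV_Halt r)"
    using assms by (auto simp: HSRV_returns_def)
  from this(2) have "hsrv_inv N D Safety (HSRV_Halt r)"
  proof (induction rule: rtranclp_induct)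
    case base
    show ?case using L by (simp add: unsafe_execs_def)
  next
    case (step s s')
    then show ?case using hsrv_inv_step by blast
  qed
  then show ?thesis by simp
qed

theorem theorem10p1:
  fixes N :: network
    and D :: "(nat \<Rightarrow> real) set"
    and Safety :: "(nat \<Rightarrow> real) \<Rightarrow> bool"
    and \<Phi> :: "lincon set"
  assumes "wf_network N"
    and "input_domain N D"
    and "encodes N \<Phi> (\<lambda>v. \<not> Safety (outp N v))"
    and "\<forall>c\<in>\<Phi>. rational_con N c"
  shows "(ICL_returns N D Safety \<Phi> UNSAT \<longrightarrow> (\<forall>x\<in>D. Safety (eval_net N x))) \<and>
         (\<forall>xs. ICL_returns N D Safety \<Phi> (SAT xs) \<longrightarrow> xs \<in> D \<and> \<not> Safety (eval_net N xs)) \<and>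
         (HSRV_returns N D Safety UNSAT \<longrightarrow> (\<forall>x\<in>D. Safety (eval_net N x))) \<and>
         (\<forall>xs. HSRV_returns N D Safety (SAT xs) \<longrightarrow> xs \<in> D \<and> \<not> Safety (eval_net N xs))"
proof (intro conjI impI allI ballI)
  show "Safety (eval_net N x)" if "ICL_returns N D Safety \<Phi> UNSAT" "x \<in> D" for x
    using sound_UNSAT_safe[OF assms(1,2) ICL_returns_sound[OF assms(3) that(1)] that(2)] .
  show "Safety (eval_net N x)" if "HSRV_returns N D Safety UNSAT" "x \<in> D" for x
    using sound_UNSAT_safe[OF assms(1,2) HSRV_returns_sound[OF that(1)] that(2)] .
qed (use ICL_returns_sound[OF assms(3)] HSRV_returns_sound in force)+

end
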